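(* Let $\alpha\in[-1,1]$, let $N>0$ be an integer, let $(\varepsilon_0,\varepsilon_1,\ldots,\varepsilon_N)\in\mathbb{R}^{N+1}$ satisfy $\max_{0\le j\le N}|\varepsilon_j|\le\varepsilon$, and define $$\eta^{\alpha,\varepsilon}_{-1}=\eta^\alpha_{-1}=0,\qquad \eta^{\alpha,\varepsilon}_0=\eta^\alpha_0+\varepsilon_0,$$ $$\eta^{\alpha,\varepsilon}_n=\gamma^\alpha_n+\frac{2\alpha n}{n+1}\,\eta^{\alpha,\varepsilon}_{n-1}-\frac{n-1}{n+1}\,\eta^{\alpha,\varepsilon}_{n-2}+\varepsilon_n,\qquad n=1,2,\ldots,N .$$ Then $$|\eta^\alpha_N-\eta^{\alpha,\varepsilon}_N|\le\bigg[\frac{1}{N+1}\sum_{j=0}^N(j+1)|U_{N-j}(\alpha)|\bigg]\varepsilon\le\frac16(N+2)(N+3)\,\varepsilon .$$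
   Context: $U_n$ is the Chebyshev polynomial of the second kind of degree $n$ ($U_n(\cos\theta)=\sin((n+1)\theta)/\sin\theta$), with $U_{-1}=0$. For $\alpha\in[-1,1]$ and $n\ge0$, $\eta_n^\alpha:=\int_{-1}^1U_n(x)\log((x-\alpha)^2)\,dx$, and $\eta^\alpha_{-1}:=0$. With the convention $0\log 0=0$, for $n\ge1$, $$\gamma_n^\alpha:=\frac{4}{n+1}\Big[(1-\alpha)\log(1-\alpha)+(1+\alpha)\log(1+\alpha)+\frac{2}{n^2-1}\Big]\quad\text{for } n \text{ even},$$ $$\gamma_n^\alpha:=\frac{4}{n+1}\Big[(1-\alpha)\log(1-\alpha)-(1+\alpha)\log(1+\alpha)\Big]\quad\text{for } n\text{ odd}.$$ (The exact values satisfy $\eta_n^\alpha=\frac{2\alpha n}{n+1}\eta_{n-1}^\alpha-\frac{n-1}{n+1}\eta_{n-2}^\alpha+\gamma_n^\alpha$ for $n\ge1$.) *)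

theory Defs
  imports "HOL-Analysis.Analysis" "HOL-Computational_Algebra.Polynomial"
    "HOL-Real_Asymp.Real_Asymp"
begin

(* The index is an integer because U_{-1} = 0 is used; that value comes out of the
   formula below, and the lemmas after it show that the description determines a
   polynomial for every n >= -1, of degree n if n >= 0. *)
definition cheb_U :: "int \<Rightarrow> real poly" where
  "cheb_U n = (THE p. \<forall>\<theta>. sin \<theta> \<noteq> 0 \<longrightarrow>
     poly p (cos \<theta>) = sin (real_of_int (n + 1) * \<theta>) / sin \<theta>)"

lemma cheb_U_eqI:
  assumes "\<And>\<theta>. sin \<theta> \<noteq> 0 \<Longrightarrow> poly p (cos \<theta>) = sin (real_of_int (n + 1) * \<theta>) / sin \<theta>"
  shows "cheb_U n = p"
  unfolding cheb_U_def
proof (rule the_equality)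
  show "\<forall>\<theta>. sin \<theta> \<noteq> 0 \<longrightarrow> poly p (cos \<theta>) = sin (real_of_int (n + 1) * \<theta>) / sin \<theta>"
    using assms by blast
next
  fix q :: "real poly"
  assume q: "\<forall>\<theta>. sin \<theta> \<noteq> 0 \<longrightarrow> poly q (cos \<theta>) = sin (real_of_int (n + 1) * \<theta>) / sin \<theta>"
  have "poly (q - p) x = 0" if "x \<in> {-1<..<1}" for x
  proof -
    have "sin (arccos x) \<noteq> 0" "cos (arccos x) = x"
      using that sin_arccos_nonzero[of x] by (auto simp: cos_arccos)
    then show ?thesis using q assms[of "arccos x"] by fastforce
  qed
  then have "{-1<..<1} \<subseteq> {x. poly (q - p) x = 0}" by blast
  moreover have "infinite {-1<..<1::real}" by (simp add: infinite_Ioo)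
  ultimately have "q - p = 0" using poly_roots_finite finite_subset by blast
  then show "q = p" by simp
qed

lemma cheb_U_exists:
  "\<exists>p q :: real poly. degree p = m \<and> degree q = Suc m \<and>
    (\<forall>\<theta>. sin \<theta> \<noteq> 0 \<longrightarrow> poly p (cos \<theta>) = sin (real (m + 1) * \<theta>) / sin \<theta>) \<and>
    (\<forall>\<theta>. sin \<theta> \<noteq> 0 \<longrightarrow> poly q (cos \<theta>) = sin (real (m + 2) * \<theta>) / sin \<theta>)"
proof (induction m)
  case 0
  show ?case
    by (rule exI[of _ 1], rule exI[of _ "[:0, 2:]"]) (simp add: sin_double)
next
  case (Suc m)
  then obtain p q :: "real poly" where d: "degree p = m" "degree q = Suc m"
    and p: "\<And>\<theta>. sin \<theta> \<noteq> 0 \<Longrightarrow> poly p (cos \<theta>) = sin (real (m + 1) * \<theta>) / sin \<theta>"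
    and q: "\<And>\<theta>. sin \<theta> \<noteq> 0 \<Longrightarrow> poly q (cos \<theta>) = sin (real (m + 2) * \<theta>) / sin \<theta>"
    by blast
  let ?r = "[:0, 2:] * q - p"
  have "q \<noteq> 0" using d by auto
  then have "degree ([:0, 2:] * q) = Suc (Suc m)"
    using d by (subst degree_mult_eq) auto
  then have "degree ([:0, 2:] * q + - p) = Suc (Suc m)"
    using d by (subst degree_add_eq_left) auto
  then have "degree ?r = Suc (Suc m)" by simp
  moreover have "poly ?r (cos \<theta>) = sin (real (Suc m + 2) * \<theta>) / sin \<theta>" if "sin \<theta> \<noteq> 0" for \<theta>
  proof -
    let ?b = "real (m + 2) * \<theta>"
    have eqs: "real (Suc m + 2) * \<theta> = ?b + \<theta>" "real (m + 1) * \<theta> = ?b - \<theta>"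
      by (simp_all add: algebra_simps)
    have "sin (?b + \<theta>) = 2 * cos \<theta> * sin ?b - sin (?b - \<theta>)"
      unfolding sin_add sin_diff by simp
    then have "sin (real (Suc m + 2) * \<theta>) = 2 * cos \<theta> * sin ?b - sin (real (m + 1) * \<theta>)"
      by (simp only: eqs)
    then show ?thesis
      using p[OF that] q[OF that] by (simp add: diff_divide_distrib)
  qed
  ultimately show ?case using d q by (intro exI[of _ q] exI[of _ ?r]) auto
qed

lemma cheb_U_properties:
  assumes "n \<ge> 0"
  shows degree_cheb_U: "degree (cheb_U n) = nat n"
    and cheb_U_cos: "sin \<theta> \<noteq> 0 \<Longrightarrow>
      poly (cheb_U n) (cos \<theta>) = sin (real_of_int (n + 1) * \<theta>) / sin \<theta>"
proof -
  obtain p :: "real poly" where d: "degree p = nat n"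
    and p: "\<And>\<theta>. sin \<theta> \<noteq> 0 \<Longrightarrow> poly p (cos \<theta>) = sin (real (nat n + 1) * \<theta>) / sin \<theta>"
    using cheb_U_exists[of "nat n"] by blast
  have *: "real (nat n + 1) = real_of_int (n + 1)" using assms by simp
  have "cheb_U n = p" by (rule cheb_U_eqI) (use p[unfolded *] in blast)
  then show "degree (cheb_U n) = nat n"
    and "sin \<theta> \<noteq> 0 \<Longrightarrow> poly (cheb_U n) (cos \<theta>) = sin (real_of_int (n + 1) * \<theta>) / sin \<theta>"
    using d p[of \<theta>, unfolded *] by auto
qed

lemma cheb_U_minus_one: "cheb_U (-1) = 0"
  by (rule cheb_U_eqI) simp

(* At x = \<alpha> the integrand has the junk value 0 (ln 0 = 0), on a null set. The integrand is
   absolutely integrable (shown below), so the Henstock-Kurzweil integral used here is the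
   Lebesgue integral. Only n >= -1 is of interest; eta at -1 is 0 by convention. *)
definition eta :: "real \<Rightarrow> int \<Rightarrow> real" where
  "eta \<alpha> n = (if n < 0 then 0
     else integral {-1..1} (\<lambda>x. poly (cheb_U n) x * ln ((x - \<alpha>)^2)))"

lemma eta_integrand_absolutely_integrable:
  "(\<lambda>x. poly p x * ln ((x - \<alpha>)^2)) absolutely_integrable_on {-1..1::real}"
proof -
  define g where "g = (\<lambda>x. (x - \<alpha>) * ln ((x - \<alpha>)^2) - 2 * x)"
  have lim: "((\<lambda>x::real. x * ln (x^2)) \<longlongrightarrow> 0) (at 0)"
  proof -
    have "((\<lambda>x::real. x * ln (x^2)) \<longlongrightarrow> 0) (at_right 0)" by real_asymp
    moreover have "((\<lambda>x::real. x * ln (x^2)) \<longlongrightarrow> 0) (at_left 0)" by real_asymp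
    ultimately show ?thesis by (simp add: filterlim_split_at)
  qed
  have c0: "isCont (\<lambda>x::real. x * ln (x^2)) x" for x
    using lim by (cases "x = 0") (auto simp: isCont_def intro!: tendsto_eq_intros)
  have cg: "continuous_on A g" for A
    unfolding g_def
    by (intro continuous_at_imp_continuous_on ballI continuous_intros
        isCont_o2[OF _ c0, where f = "\<lambda>x. x - \<alpha>"])
  have dg: "(g has_vector_derivative ln ((x - \<alpha>)^2)) (at x)" if "x \<noteq> \<alpha>" for x
    unfolding g_def has_real_derivative_iff_has_vector_derivative[symmetric]
    using that
    by (auto intro!: derivative_eq_intros simp: zero_less_mult_iff power2_eq_square divide_simps)
  have int: "(\<lambda>x. ln ((x - \<alpha>)^2)) integrable_on {a..b}" for a b :: real
  proof (cases "a \<le> b")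
    case True
    then show ?thesis
      using fundamental_theorem_of_calculus_strong[of "{\<alpha>}" a b g "\<lambda>x. ln ((x - \<alpha>)^2)"] dg cg
      by (auto simp: integrable_on_def)
  qed auto
  (* a function bounded above with a Henstock-Kurzweil integral is absolutely integrable *)
  define C where "C = ln ((1 + \<bar>\<alpha>\<bar>)^2) + 1"
  have bd: "ln ((x - \<alpha>)^2) \<le> C" if "x \<in> {-1..1}" for x
  proof (cases "x = \<alpha>")
    case True
    have "(1 + \<bar>\<alpha>\<bar>)^2 \<ge> 1" by (simp add: one_le_power)
    then show ?thesis using True by (simp add: C_def)
  next
    case False
    have "\<bar>x - \<alpha>\<bar> \<le> \<bar>1 + \<bar>\<alpha>\<bar>\<bar>" using that by auto
    then have "(x - \<alpha>)^2 \<le> (1 + \<bar>\<alpha>\<bar>)^2" by (simp only: abs_le_square_iff)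
    moreover have "(x - \<alpha>)^2 > 0" using False by simp
    ultimately have "ln ((x - \<alpha>)^2) \<le> ln ((1 + \<bar>\<alpha>\<bar>)^2)" by simp
    then show ?thesis by (simp add: C_def)
  qed
  have abs: "(\<lambda>x. ln ((x - \<alpha>)^2)) absolutely_integrable_on {-1..1}"
    by (rule absolutely_integrable_absolutely_integrable_ubound
        [where g = "\<lambda>_. C"]) (use int bd in auto)
  show ?thesis
    by (rule absolutely_integrable_bounded_measurable_product_real)
       (auto intro!: abs compact_imp_bounded compact_continuous_image
         continuous_imp_measurable_on_sets_lebesgue continuous_intros)
qed

(* The convention 0 log 0 = 0 holds automatically in the products below. Only n >= 1 is of
   interest. *)
definition gamma_rec :: "real \<Rightarrow> int \<Rightarrow> real" where
  "gamma_rec \<alpha> n =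
     (if even n
      then 4 / (real_of_int n + 1) *
             ((1 - \<alpha>) * ln (1 - \<alpha>) + (1 + \<alpha>) * ln (1 + \<alpha>) + 2 / ((real_of_int n)^2 - 1))
      else 4 / (real_of_int n + 1) *
             ((1 - \<alpha>) * ln (1 - \<alpha>) - (1 + \<alpha>) * ln (1 + \<alpha>)))"

end

theory Submission
  imports Defs
begin

text \<open>
  Write \<open>T\<^sub>n\<close> for the Chebyshev polynomial of the first kind and \<open>D\<^sub>n = (n + 1)(\<eta>\<^sup>\<epsilon>\<^sub>n - \<eta>\<^sub>n)\<close> for
  the rescaled error. After multiplication by \<open>n + 1\<close>, the coefficients of the recurrence no
  longer depend on \<open>n\<close>: subtracting the exact recurrence from the perturbed one leaves
  \<open>D\<^sub>n = 2\<alpha>D\<^bsub>n-1\<^esub> - D\<^bsub>n-2\<^esub> + (n + 1)\<epsilon>\<^sub>n\<close>. Its homogeneous part is the three-term recurrence that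
  the numbers \<open>U\<^sub>n(\<alpha>)\<close> satisfy, so \<open>U\<close> is its fundamental solution and
  \<open>D\<^sub>N = \<Sum>\<^sub>j (j + 1)\<epsilon>\<^sub>j U\<^bsub>N-j\<^esub>(\<alpha>)\<close> (\<open>forced_cheb_recurrence_solution\<close>). The triangle inequality
  is the first bound. The second follows from \<open>\<bar>U\<^sub>m(\<alpha>)\<bar> \<le> m + 1\<close> on \<open>[-1, 1]\<close>
  (\<open>abs_chebS_le\<close>) and the sum \<open>\<Sum>\<^sub>j (j + 1)(N - j + 1) = (N + 1)(N + 2)(N + 3)/6\<close>.

  It remains to see that the integrals themselves obey the recurrence
  (\<open>eta_recurrence\<close>). The combination of \<open>U\<^sub>n\<close>, \<open>U\<^bsub>n-1\<^esub>\<close>, \<open>U\<^bsub>n-2\<^esub>\<close> that occurs in it is an exact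
  derivative,
  \<open>(n + 1)U\<^sub>n - 2\<alpha>nU\<^bsub>n-1\<^esub> + (n - 1)U\<^bsub>n-2\<^esub> = 2((x - \<alpha>)T\<^sub>n)'\<close>, because \<open>T\<^sub>n' = nU\<^bsub>n-1\<^esub>\<close> and
  \<open>U\<^sub>n - U\<^bsub>n-2\<^esub> = 2T\<^sub>n\<close>. The factor \<open>x - \<alpha>\<close> cancels the singularity of the derivative of the
  logarithm, so integration by parts (\<open>has_integral_pderiv_ln\<close>) leaves boundary terms and
  \<open>-4\<integral>T\<^sub>n\<close>, which together are \<open>(n + 1)\<gamma>\<^sub>n\<close>.
\<close>

section \<open>Chebyshev polynomials of both kinds\<close>

text \<open>
  The pair \<open>(T\<^sub>n, U\<^bsub>n-1\<^esub>)\<close>. The equations are the addition formulas for \<open>cos (n\<theta> + \<theta>)\<close> and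
  \<open>sin (n\<theta> + \<theta>) / sin \<theta>\<close>. With the second index shifted, the pair starts at \<open>(1, 0)\<close>, and \<open>U\<^bsub>-1\<^esub>\<close>
  needs no case of its own.
\<close>

fun chebT :: "nat \<Rightarrow> real poly" and chebS :: "nat \<Rightarrow> real poly" where
  "chebT 0 = 1"
| "chebT (Suc n) = [:0, 1:] * chebT n - [:1, 0, -1:] * chebS n"
| "chebS 0 = 0"
| "chebS (Suc n) = [:0, 1:] * chebS n + chebT n"

lemma chebT_chebS_cos:
  "poly (chebT n) (cos \<theta>) = cos (real n * \<theta>) \<and>
   poly (chebS n) (cos \<theta>) * sin \<theta> = sin (real n * \<theta>)"
proof (induction n)
  case (Suc n)
  have T: "poly (chebT n) (cos \<theta>) = cos (real n * \<theta>)"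
    and S: "poly (chebS n) (cos \<theta>) * sin \<theta> = sin (real n * \<theta>)"
    using Suc by auto
  have arg: "real (Suc n) * \<theta> = real n * \<theta> + \<theta>"
    by (simp add: algebra_simps)
  have "poly (chebT (Suc n)) (cos \<theta>)
      = cos \<theta> * poly (chebT n) (cos \<theta>) - (1 - (cos \<theta>)\<^sup>2) * poly (chebS n) (cos \<theta>)"
    by (simp add: algebra_simps power2_eq_square)
  also have "\<dots> = cos \<theta> * cos (real n * \<theta>) - sin \<theta> * sin (real n * \<theta>)"
    unfolding T S[symmetric] sin_squared_eq[symmetric] by (simp add: power2_eq_square)
  also have "\<dots> = cos (real (Suc n) * \<theta>)"
    unfolding arg cos_add by simp
  finally have 1: "poly (chebT (Suc n)) (cos \<theta>) = cos (real (Suc n) * \<theta>)" .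
  have "poly (chebS (Suc n)) (cos \<theta>) * sin \<theta>
      = cos \<theta> * (poly (chebS n) (cos \<theta>) * sin \<theta>) + poly (chebT n) (cos \<theta>) * sin \<theta>"
    by (simp add: algebra_simps)
  also have "\<dots> = sin (real (Suc n) * \<theta>)"
    unfolding T S arg sin_add by simp
  finally show ?case using 1 by blast
qed simp

lemma cheb_U_eq_chebS: "cheb_U (int n - 1) = chebS n"
proof (rule cheb_U_eqI)
  fix \<theta> :: real
  assume "sin \<theta> \<noteq> 0"
  then show "poly (chebS n) (cos \<theta>) = sin (real_of_int (int n - 1 + 1) * \<theta>) / sin \<theta>"
    using chebT_chebS_cos[of n \<theta>] by (simp add: field_simps)
qed

lemma chebS_three_term:
  "poly (chebS (Suc (Suc n))) x = 2 * x * poly (chebS (Suc n)) x - poly (chebS n) x"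
  by (simp add: algebra_simps)

lemma abs_chebT_le:
  assumes "x \<in> {-1..1}"
  shows "\<bar>poly (chebT n) x\<bar> \<le> 1"
  using chebT_chebS_cos[of n "arccos x"] assms by simp

text \<open>
  Unfolding the recursion gives \<open>U\<^bsub>n-1\<^esub> = \<Sum>\<^bsub>k<n\<^esub> x\<^bsup>n-1-k\<^esup> T\<^sub>k\<close>, a sum of \<open>n\<close> terms of modulus at
  most 1. The endpoints, where \<open>sin \<theta> = 0\<close>, are thereby included.
\<close>

lemma abs_chebS_le:
  assumes "x \<in> {-1..1}"
  shows "\<bar>poly (chebS n) x\<bar> \<le> real n"
proof (induction n)
  case (Suc n)
  have "\<bar>x * poly (chebS n) x\<bar> \<le> 1 * real n"
    unfolding abs_mult using assms Suc by (intro mult_mono) auto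
  then show ?case using abs_chebT_le[OF assms, of n] by simp
qed simp

text \<open>
  The second equation holds for the reason that the first does: both are derivatives with respect
  to \<open>\<theta>\<close> of the trigonometric forms. Proved jointly, they follow from the recursion alone.
\<close>

lemma pderiv_chebT_chebS:
  "poly (pderiv (chebT n)) x = real n * poly (chebS n) x \<and>
   (1 - x\<^sup>2) * poly (pderiv (chebS n)) x = x * poly (chebS n) x - real n * poly (chebT n) x"
proof (induction n)
  case (Suc n)
  have T: "poly (pderiv (chebT n)) x = real n * poly (chebS n) x"
    and S: "(1 - x\<^sup>2) * poly (pderiv (chebS n)) x
      = x * poly (chebS n) x - real n * poly (chebT n) x"
    using Suc by auto
  have "poly (pderiv (chebT (Suc n))) x = poly (chebT n) x + x * poly (pderiv (chebT n)) x
      + 2 * x * poly (chebS n) x - (1 - x\<^sup>2) * poly (pderiv (chebS n)) x"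
    unfolding chebT.simps pderiv_diff pderiv_mult
    by (simp add: pderiv_pCons algebra_simps power2_eq_square)
  also have "\<dots> = real (Suc n) * poly (chebS (Suc n)) x"
    unfolding T S by (simp add: algebra_simps)
  finally have 1: "poly (pderiv (chebT (Suc n))) x = real (Suc n) * poly (chebS (Suc n)) x" .
  have "(1 - x\<^sup>2) * poly (pderiv (chebS (Suc n))) x = (1 - x\<^sup>2) * poly (chebS n) x
      + x * ((1 - x\<^sup>2) * poly (pderiv (chebS n)) x) + (1 - x\<^sup>2) * poly (pderiv (chebT n)) x"
    unfolding chebS.simps pderiv_add pderiv_mult
    by (simp add: pderiv_pCons algebra_simps)
  also have "\<dots> = x * poly (chebS (Suc n)) x - real (Suc n) * poly (chebT (Suc n)) x"
    unfolding T S by (simp add: algebra_simps power2_eq_square)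
  finally show ?case using 1 by blast
qed simp

lemma chebT_one: "poly (chebT n) 1 = 1"
  using chebT_chebS_cos[of n 0] by simp

lemma chebT_minus_one: "poly (chebT n) (-1) = (-1) ^ n"
  using chebT_chebS_cos[of n pi] by simp

section \<open>The recurrence for the logarithmic integrals\<close>

text \<open>
  By Chebyshev's differential equation, \<open>((1 - x\<^sup>2)T\<^sub>n' + xT\<^sub>n)' = (1 - n\<^sup>2)T\<^sub>n\<close>; at \<open>\<plusminus>1\<close> only the term
  \<open>xT\<^sub>n\<close> survives. For \<open>n = 1\<close> the equation is void and \<open>T\<^sub>1 = x\<close> is integrated directly.
\<close>

lemma has_integral_chebT:
  assumes "n \<ge> 1"
  shows "(poly (chebT n) has_integral (if even n then - 2 / ((real n)\<^sup>2 - 1) else 0)) {-1..1}"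
proof (cases "n = 1")
  case True
  have "((\<lambda>x::real. x) has_integral (1\<^sup>2 / 2 - (-1)\<^sup>2 / 2)) {-1..1}"
    by (rule fundamental_theorem_of_calculus)
       (auto intro!: derivative_eq_intros
         simp flip: has_real_derivative_iff_has_vector_derivative)
  moreover have "poly (chebT n) = (\<lambda>x. x)"
    using True by (auto simp: fun_eq_iff)
  ultimately show ?thesis using True by simp
next
  case False
  then have "real n > 1" using assms by simp
  then have n: "(real n)\<^sup>2 - 1 > 0" by simp
  define F where "F = [:1, 0, -1:] * smult (real n) (chebS n) + [:0, 1:] * chebT n"
  have dF: "poly (pderiv F) x = (1 - (real n)\<^sup>2) * poly (chebT n) x" for x
  proof -
    have T: "poly (pderiv (chebT n)) x = real n * poly (chebS n) x"
      and S: "(1 - x\<^sup>2) * poly (pderiv (chebS n)) x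
        = x * poly (chebS n) x - real n * poly (chebT n) x"
      using pderiv_chebT_chebS[of n x] by auto
    have "poly (pderiv F) x = real n * ((1 - x\<^sup>2) * poly (pderiv (chebS n)) x)
        - 2 * x * real n * poly (chebS n) x + poly (chebT n) x + x * poly (pderiv (chebT n)) x"
      unfolding F_def pderiv_add pderiv_mult pderiv_smult
      by (simp add: pderiv_pCons algebra_simps power2_eq_square)
    then show ?thesis
      unfolding T S by (simp add: algebra_simps power2_eq_square)
  qed
  have "(poly (pderiv F) has_integral (poly F 1 - poly F (-1))) {-1..1}"
    by (rule fundamental_theorem_of_calculus)
       (auto intro!: poly_DERIV[THEN DERIV_subset]
         simp flip: has_real_derivative_iff_has_vector_derivative)
  also have "poly F 1 - poly F (-1) = 1 + (-1) ^ n"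
    by (simp add: F_def chebT_one chebT_minus_one)
  finally have "((\<lambda>x. poly (pderiv F) x / (1 - (real n)\<^sup>2)) has_integral
      ((1 + (-1) ^ n) / (1 - (real n)\<^sup>2))) {-1..1}"
    by (rule has_integral_divide)
  moreover have "(1 + (-1) ^ n) / (1 - (real n)\<^sup>2)
      = (if even n then - 2 / ((real n)\<^sup>2 - 1) else 0)"
    using minus_divide_divide[of "-2" "(real n)\<^sup>2 - 1"] by simp
  moreover have "(\<lambda>x. poly (pderiv F) x / (1 - (real n)\<^sup>2)) = poly (chebT n)"
    using n by (simp add: dF fun_eq_iff)
  ultimately show ?thesis by (simp only:)
qed

lemma continuous_mult_ln_square: "isCont (\<lambda>x::real. (x - \<alpha>) * ln ((x - \<alpha>)\<^sup>2)) y"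
proof -
  have "((\<lambda>x::real. x * ln (x\<^sup>2)) \<longlongrightarrow> 0) (at_right 0)" by real_asymp
  moreover have "((\<lambda>x::real. x * ln (x\<^sup>2)) \<longlongrightarrow> 0) (at_left 0)" by real_asymp
  ultimately have lim: "((\<lambda>x::real. x * ln (x\<^sup>2)) \<longlongrightarrow> 0) (at 0)"
    by (simp add: filterlim_split_at)
  have c0: "isCont (\<lambda>x::real. x * ln (x\<^sup>2)) x" for x
    using lim by (cases "x = 0") (auto simp: isCont_def intro!: tendsto_eq_intros)
  show ?thesis
    by (rule isCont_o2[OF _ c0, where f = "\<lambda>x. x - \<alpha>"]) (intro continuous_intros)
qed

text \<open>
  Integration by parts. The product \<open>(x - \<alpha>) p(x) log ((x - \<alpha>)\<^sup>2)\<close> is continuous also at \<open>\<alpha>\<close> and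
  differentiable elsewhere, so the fundamental theorem with one exceptional point applies across
  the singularity. If \<open>\<alpha>\<close> is an endpoint, its boundary term is 0, which is also the limit.
\<close>

lemma has_integral_pderiv_ln:
  fixes a b \<alpha> :: real
  assumes "a \<le> b"
  shows "((\<lambda>x. poly (pderiv ([:- \<alpha>, 1:] * p)) x * ln ((x - \<alpha>)\<^sup>2)) has_integral
    ((b - \<alpha>) * ln ((b - \<alpha>)\<^sup>2) * poly p b - (a - \<alpha>) * ln ((a - \<alpha>)\<^sup>2) * poly p a
      - 2 * integral {a..b} (poly p))) {a..b}"
proof -
  define G where "G = (\<lambda>x. (x - \<alpha>) * ln ((x - \<alpha>)\<^sup>2) * poly p x)"
  define h where "h = (\<lambda>x. poly (pderiv ([:- \<alpha>, 1:] * p)) x * ln ((x - \<alpha>)\<^sup>2))"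
  have cG: "continuous_on {a..b} G"
    unfolding G_def
  proof (rule continuous_on_mult)
    show "continuous_on {a..b} (\<lambda>x. (x - \<alpha>) * ln ((x - \<alpha>)\<^sup>2))"
      by (intro continuous_at_imp_continuous_on ballI continuous_mult_ln_square)
  qed (intro continuous_intros)
  have dG: "(G has_vector_derivative h x + 2 * poly p x) (at x)" if "x \<noteq> \<alpha>" for x
  proof -
    have "((\<lambda>x. (x - \<alpha>) * ln ((x - \<alpha>)\<^sup>2)) has_real_derivative ln ((x - \<alpha>)\<^sup>2) + 2) (at x)"
      using that
      by (auto intro!: derivative_eq_intros
          simp: zero_less_mult_iff power2_eq_square divide_simps)
        (simp add: algebra_simps)
    from DERIV_mult[OF this poly_DERIV[of p x]] show ?thesis
      unfolding has_real_derivative_iff_has_vector_derivative[symmetric] G_def h_def pderiv_mult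
      by (rule DERIV_cong) (simp add: pderiv_pCons algebra_simps)
  qed
  have "((\<lambda>x. h x + 2 * poly p x) has_integral (G b - G a)) {a..b}"
    using fundamental_theorem_of_calculus_strong[of "{\<alpha>}" a b G "\<lambda>x. h x + 2 * poly p x"]
      dG cG assms by auto
  moreover have "poly p integrable_on {a..b}"
    by (intro integrable_continuous_real continuous_intros)
  then have "((\<lambda>x. 2 * poly p x) has_integral (2 * integral {a..b} (poly p))) {a..b}"
    by (intro has_integral_mult_right integrable_integral)
  ultimately have "((\<lambda>x. h x + 2 * poly p x - 2 * poly p x) has_integral
      (G b - G a - 2 * integral {a..b} (poly p))) {a..b}"
    by (rule has_integral_diff)
  then show ?thesis by (simp add: h_def G_def)
qed

text \<open>For \<open>n = 0\<close> the integrand vanishes, in accordance with the convention for \<open>\<eta>\<^bsub>-1\<^esub>\<close>.\<close>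

lemma has_integral_eta:
  "((\<lambda>x. poly (chebS n) x * ln ((x - \<alpha>)\<^sup>2)) has_integral eta \<alpha> (int n - 1)) {-1..1}"
proof -
  have "(\<lambda>x. poly (chebS n) x * ln ((x - \<alpha>)\<^sup>2)) integrable_on {-1..1}"
    using eta_integrand_absolutely_integrable by (rule set_lebesgue_integral_eq_integral(1))
  moreover have "eta \<alpha> (int n - 1) = integral {-1..1} (\<lambda>x. poly (chebS n) x * ln ((x - \<alpha>)\<^sup>2))"
    by (cases "n = 0") (simp_all add: eta_def cheb_U_eq_chebS)
  ultimately show ?thesis by (simp add: has_integral_integrable_integral)
qed

lemma cheb_combination_eq_pderiv:
  "poly (smult 2 (pderiv ([:- \<alpha>, 1:] * chebT (Suc n)))) x
    = (real n + 2) * poly (chebS (Suc (Suc n))) x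
      - 2 * \<alpha> * (real n + 1) * poly (chebS (Suc n)) x + real n * poly (chebS n) x"
proof -
  have T: "poly (pderiv (chebT (Suc n))) x = (real n + 1) * poly (chebS (Suc n)) x"
    using pderiv_chebT_chebS[of "Suc n" x] by (simp only: of_nat_Suc add.commute)
  have "poly (smult 2 (pderiv ([:- \<alpha>, 1:] * chebT (Suc n)))) x
      = 2 * ((x - \<alpha>) * poly (pderiv (chebT (Suc n))) x + poly (chebT (Suc n)) x)"
    unfolding pderiv_mult by (simp add: pderiv_pCons algebra_simps del: chebT.simps)
  also have "\<dots> = (real n + 2) * poly (chebS (Suc (Suc n))) x
      - 2 * \<alpha> * (real n + 1) * poly (chebS (Suc n)) x + real n * poly (chebS n) x"
    unfolding T by (simp add: algebra_simps power2_eq_square)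
  finally show ?thesis .
qed

lemma eta_recurrence:
  assumes "\<alpha> \<in> {-1..1}"
  shows "(real n + 2) * eta \<alpha> (int n + 1) - 2 * \<alpha> * (real n + 1) * eta \<alpha> (int n)
      + real n * eta \<alpha> (int n - 1)
    = (real n + 2) * gamma_rec \<alpha> (int n + 1)"
proof -
  let ?L = "\<lambda>x. ln ((x - \<alpha>)\<^sup>2)"
  let ?c = "\<lambda>x. poly (smult 2 (pderiv ([:- \<alpha>, 1:] * chebT (Suc n)))) x * ?L x"
  define J :: real where "J = (if even (Suc n) then - 2 / ((real (Suc n))\<^sup>2 - 1) else 0)"
  have J: "integral {-1..1} (poly (chebT (Suc n))) = J"
    unfolding J_def by (intro integral_unique has_integral_chebT) simp
  have E: "((\<lambda>x. poly (chebS (Suc (Suc n))) x * ?L x) has_integral eta \<alpha> (int n + 1)) {-1..1}"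
    "((\<lambda>x. poly (chebS (Suc n)) x * ?L x) has_integral eta \<alpha> (int n)) {-1..1}"
    "((\<lambda>x. poly (chebS n) x * ?L x) has_integral eta \<alpha> (int n - 1)) {-1..1}"
    using has_integral_eta[of "Suc (Suc n)" \<alpha>] has_integral_eta[of "Suc n" \<alpha>]
      has_integral_eta[of n \<alpha>] by (simp_all add: add.commute del: chebS.simps)
  have "((\<lambda>x. (real n + 2) * (poly (chebS (Suc (Suc n))) x * ?L x)
        - 2 * \<alpha> * (real n + 1) * (poly (chebS (Suc n)) x * ?L x)
        + real n * (poly (chebS n) x * ?L x)) has_integral
      ((real n + 2) * eta \<alpha> (int n + 1) - 2 * \<alpha> * (real n + 1) * eta \<alpha> (int n)
        + real n * eta \<alpha> (int n - 1))) {-1..1}"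
    by (intro has_integral_add has_integral_diff has_integral_mult_right E)
  then have 1: "(?c has_integral
      ((real n + 2) * eta \<alpha> (int n + 1) - 2 * \<alpha> * (real n + 1) * eta \<alpha> (int n)
        + real n * eta \<alpha> (int n - 1))) {-1..1}"
    unfolding cheb_combination_eq_pderiv
    by (rule has_integral_eq[rotated]) (simp add: algebra_simps del: chebS.simps)
  have "((\<lambda>x. 2 * (poly (pderiv ([:- \<alpha>, 1:] * chebT (Suc n))) x * ?L x)) has_integral
      2 * ((1 - \<alpha>) * ?L 1 * poly (chebT (Suc n)) 1
        - (-1 - \<alpha>) * ?L (-1) * poly (chebT (Suc n)) (-1) - 2 * J)) {-1..1}"
    unfolding J[symmetric] by (intro has_integral_mult_right has_integral_pderiv_ln) simp
  moreover have "?L 1 = 2 * ln (1 - \<alpha>)" "?L (-1) = 2 * ln (1 + \<alpha>)"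
  proof -
    \<comment> \<open>With \<open>ln 0 = 0\<close> these also hold if \<open>\<alpha>\<close> is an endpoint.\<close>
    have sq: "ln (y\<^sup>2) = 2 * ln y" if "y \<ge> 0" for y :: real
      using that by (cases "y = 0") (simp_all add: ln_realpow)
    have "(-1 - \<alpha>)\<^sup>2 = (1 + \<alpha>)\<^sup>2" by (simp add: power2_eq_square algebra_simps)
    then show "?L 1 = 2 * ln (1 - \<alpha>)" "?L (-1) = 2 * ln (1 + \<alpha>)"
      using assms sq[of "1 - \<alpha>"] sq[of "1 + \<alpha>"] by simp_all
  qed
  ultimately have 2: "(?c has_integral
      2 * ((1 - \<alpha>) * (2 * ln (1 - \<alpha>)) - (-1 - \<alpha>) * (2 * ln (1 + \<alpha>)) * (-1) ^ Suc n - 2 * J))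
      {-1..1}"
    by (simp only: chebT_one chebT_minus_one mult_1_right poly_smult mult.assoc)
  define X where "X = (if even n
    then (1 - \<alpha>) * ln (1 - \<alpha>) - (1 + \<alpha>) * ln (1 + \<alpha>)
    else (1 - \<alpha>) * ln (1 - \<alpha>) + (1 + \<alpha>) * ln (1 + \<alpha>) + 2 / ((real (Suc n))\<^sup>2 - 1))"
  have "gamma_rec \<alpha> (int n + 1) = 4 / (real n + 2) * X"
    by (simp add: gamma_rec_def X_def add.commute)
  then have "(real n + 2) * gamma_rec \<alpha> (int n + 1) = 4 * X"
    by simp
  moreover have "2 * ((1 - \<alpha>) * (2 * ln (1 - \<alpha>))
      - (-1 - \<alpha>) * (2 * ln (1 + \<alpha>)) * (-1) ^ Suc n - 2 * J) = 4 * X"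
    by (cases "even n") (simp_all add: X_def J_def algebra_simps)
  ultimately show ?thesis using has_integral_unique[OF 1 2] by (simp only:)
qed

section \<open>Propagation of the perturbations\<close>

text \<open>
  Discrete variation of constants: \<open>U\<close> is the solution of the homogeneous recurrence with the
  initial values 0 and 1, so the solution with a source is the convolution of that source with \<open>U\<close>.
\<close>

lemma forced_cheb_recurrence_solution:
  fixes D f :: "nat \<Rightarrow> real"
  assumes "D 0 = 0" and "D 1 = f 0"
    and "\<And>n. n < N \<Longrightarrow> D (Suc (Suc n)) = 2 * x * D (Suc n) - D n + f (Suc n)"
    and "n \<le> Suc N"
  shows "D n = (\<Sum>j<n. f j * poly (chebS (n - j)) x)"
  using assms(4)
proof (induction n rule: less_induct)
  case (less n)
  consider "n = 0" | "n = 1" | m where "n = Suc (Suc m)"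
  proof (cases n)
    case (Suc k)
    then show ?thesis by (cases k) (simp_all add: that)
  qed (simp add: that)
  then show ?case
  proof cases
    case 3
    have "D n = 2 * x * D (Suc m) - D m + f (Suc m)"
      using 3 less.prems assms(3)[of m] by simp
    also have "D (Suc m) = (\<Sum>j<Suc m. f j * poly (chebS (Suc m - j)) x)"
      using less 3 by simp
    also have "D m = (\<Sum>j<m. f j * poly (chebS (m - j)) x)"
      using less 3 by simp
    \<comment> \<open>The extra term \<open>j = m\<close> contains \<open>U\<^bsub>-1\<^esub> = 0\<close>.\<close>
    also have "\<dots> = (\<Sum>j<Suc m. f j * poly (chebS (m - j)) x)"
      by simp
    finally have "D n = (\<Sum>j<Suc m. f j *
        (2 * x * poly (chebS (Suc m - j)) x - poly (chebS (m - j)) x)) + f (Suc m)"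
      by (simp only: right_diff_distrib sum_subtractf sum_distrib_left mult.left_commute)
    also have "\<dots> = (\<Sum>j<Suc m. f j * poly (chebS (n - j)) x) + f (Suc m)"
    proof -
      have "2 * x * poly (chebS (Suc m - j)) x - poly (chebS (m - j)) x
          = poly (chebS (n - j)) x" if "j < Suc m" for j
        using that 3 chebS_three_term[of "m - j" x]
        by (simp add: Suc_diff_le algebra_simps del: chebS.simps)
      then show ?thesis by simp
    qed
    also have "\<dots> = (\<Sum>j<n. f j * poly (chebS (n - j)) x)"
      using 3 by simp
    finally show ?thesis .
  qed (use assms(1,2) in simp_all)
qed

lemma sum_Suc_mult_reverse:
  "(\<Sum>j\<le>n. (real j + 1) * (real (n - j) + 1)) = (real n + 1) * (real n + 2) * (real n + 3) / 6"
proof (induction n)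
  case (Suc n)
  \<comment> \<open>Raising \<open>n\<close> by one adds \<open>j + 1\<close> to every term, hence a triangular number in total.\<close>
  have tri: "(\<Sum>j\<le>m. real j + 1) = (real m + 1) * (real m + 2) / 2" for m
    by (induction m) (simp_all add: field_simps)
  have "(\<Sum>j\<le>n. (real j + 1) * (real (Suc n - j) + 1))
      = (\<Sum>j\<le>n. (real j + 1) * (real (n - j) + 1) + (real j + 1))"
    by (rule sum.cong) (auto simp: of_nat_diff algebra_simps)
  also have "\<dots> = (real n + 1) * (real n + 2) * (real n + 3) / 6
      + (real n + 1) * (real n + 2) / 2"
    by (subst sum.distrib) (simp only: Suc tri)
  finally show ?case by (simp add: field_simps)
qed simp

lemma sum_int_eq_sum_nat: "(\<Sum>j=0..int n. g j) = (\<Sum>j\<le>n. g (int j))"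
  by (rule sum.reindex_bij_witness[of _ int nat]) auto

theorem theorem4p1:
  fixes \<alpha> e :: real and N :: int
    and \<epsilon> :: "int \<Rightarrow> real"
    and eta_eps :: "int \<Rightarrow> real"
  assumes "\<alpha> \<in> {-1..1}"
    and "N > 0"
    and "(MAX j\<in>{0..N}. \<bar>\<epsilon> j\<bar>) \<le> e"
    and "eta_eps (-1) = eta \<alpha> (-1)"
    and "eta_eps 0 = eta \<alpha> 0 + \<epsilon> 0"
    and "\<And>n. n \<in> {1..N} \<Longrightarrow>
      eta_eps n = gamma_rec \<alpha> n
        + 2 * \<alpha> * real_of_int n / (real_of_int n + 1) * eta_eps (n - 1)
        - (real_of_int n - 1) / (real_of_int n + 1) * eta_eps (n - 2)
        + \<epsilon> n"
  shows "\<bar>eta \<alpha> N - eta_eps N\<bar>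
      \<le> (1 / (real_of_int N + 1)
          * (\<Sum>j=0..N. (real_of_int j + 1) * \<bar>poly (cheb_U (N - j)) \<alpha>\<bar>)) * e
    \<and> (1 / (real_of_int N + 1)
          * (\<Sum>j=0..N. (real_of_int j + 1) * \<bar>poly (cheb_U (N - j)) \<alpha>\<bar>)) * e
      \<le> 1 / 6 * (real_of_int N + 2) * (real_of_int N + 3) * e"
proof -
  define M where "M = nat N"
  have N: "N = int M" using assms(2) by (simp add: M_def)
  have eps: "\<bar>\<epsilon> j\<bar> \<le> e" if "j \<in> {0..N}" for j
  proof -
    have "\<bar>\<epsilon> j\<bar> \<le> (MAX j\<in>{0..N}. \<bar>\<epsilon> j\<bar>)" using that by (intro Max_ge) auto
    with assms(3) show ?thesis by simp
  qed
  have e: "e \<ge> 0" using eps[of 0] assms(2) by simp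
  \<comment> \<open>Indices are shifted by one so that the sequence starts with the value at \<open>-1\<close>.\<close>
  define D where "D n = real n * (eta_eps (int n - 1) - eta \<alpha> (int n - 1))" for n :: nat
  define S where "S j = poly (chebS (Suc M - j)) \<alpha>" for j
  have "D (Suc M) = (\<Sum>j<Suc M. (real j + 1) * \<epsilon> (int j) * poly (chebS (Suc M - j)) \<alpha>)"
  proof (rule forced_cheb_recurrence_solution[where N = M])
    fix n assume "n < M"
    have cancel: "k * (g + a / k * b - c / k * d + s) = k * g + a * b - c * d + k * s"
      if "k \<noteq> 0" for a b c d g k s :: real
      using that by (simp add: field_simps)
    from \<open>n < M\<close> have "eta_eps (int n + 1) = gamma_rec \<alpha> (int n + 1)
        + 2 * \<alpha> * (real n + 1) / (real n + 2) * eta_eps (int n)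
        - real n / (real n + 2) * eta_eps (int n - 1) + \<epsilon> (int n + 1)"
      using assms(6)[of "int n + 1"] N by (simp add: algebra_simps)
    then have "(real n + 2) * eta_eps (int n + 1) = (real n + 2) * gamma_rec \<alpha> (int n + 1)
        + 2 * \<alpha> * (real n + 1) * eta_eps (int n)
        - real n * eta_eps (int n - 1) + (real n + 2) * \<epsilon> (int n + 1)"
      using cancel[of "real n + 2"] by simp
    then show "D (Suc (Suc n)) = 2 * \<alpha> * D (Suc n) - D n + (real (Suc n) + 1) * \<epsilon> (int (Suc n))"
      using eta_recurrence[OF assms(1), of n] by (simp add: D_def algebra_simps)
  qed (use assms(5) in \<open>simp_all add: D_def\<close>)
  then have D: "D (Suc M) = (\<Sum>j\<le>M. (real j + 1) * \<epsilon> (int j) * S j)"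
    by (simp only: S_def lessThan_Suc_atMost)
  have sum: "(\<Sum>j=0..N. (real_of_int j + 1) * \<bar>poly (cheb_U (N - j)) \<alpha>\<bar>)
      = (\<Sum>j\<le>M. (real j + 1) * \<bar>S j\<bar>)"
  proof -
    have "cheb_U (int M - int j) = chebS (Suc M - j)" if "j \<le> M" for j
      using that cheb_U_eq_chebS[of "Suc M - j"] by (simp add: of_nat_diff algebra_simps)
    then show ?thesis
      unfolding N sum_int_eq_sum_nat S_def by (intro sum.cong) auto
  qed
  have "\<bar>D (Suc M)\<bar> \<le> (\<Sum>j\<le>M. \<bar>(real j + 1) * \<epsilon> (int j) * S j\<bar>)"
    unfolding D by (rule sum_abs)
  also have "\<dots> \<le> (\<Sum>j\<le>M. (real j + 1) * \<bar>S j\<bar> * e)"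
  proof (rule sum_mono)
    fix j assume "j \<in> {..M}"
    then have "(real j + 1) * \<bar>S j\<bar> * \<bar>\<epsilon> (int j)\<bar> \<le> (real j + 1) * \<bar>S j\<bar> * e"
      using eps[of "int j"] N by (intro mult_left_mono) auto
    then show "\<bar>(real j + 1) * \<epsilon> (int j) * S j\<bar> \<le> (real j + 1) * \<bar>S j\<bar> * e"
      by (simp add: abs_mult mult_ac)
  qed
  finally have "\<bar>D (Suc M)\<bar> \<le> (\<Sum>j\<le>M. (real j + 1) * \<bar>S j\<bar>) * e"
    by (simp only: sum_distrib_right)
  moreover have "\<bar>D (Suc M)\<bar> = (real M + 1) * \<bar>eta \<alpha> N - eta_eps N\<bar>"
    by (simp add: D_def N abs_mult abs_minus_commute)
  ultimately have first: "\<bar>eta \<alpha> N - eta_eps N\<bar>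
      \<le> (1 / (real M + 1) * (\<Sum>j\<le>M. (real j + 1) * \<bar>S j\<bar>)) * e"
    by (simp add: field_simps)
  have "(\<Sum>j\<le>M. (real j + 1) * \<bar>S j\<bar>) \<le> (\<Sum>j\<le>M. (real j + 1) * (real (M - j) + 1))"
  proof (rule sum_mono, rule mult_left_mono)
    fix j assume "j \<in> {..M}"
    then show "\<bar>S j\<bar> \<le> real (M - j) + 1"
      using abs_chebS_le[OF assms(1), of "Suc M - j"] by (simp add: S_def Suc_diff_le)
  qed simp
  also have "\<dots> = (real M + 1) * (1 / 6 * (real M + 2) * (real M + 3))"
    unfolding sum_Suc_mult_reverse by simp
  finally have "1 / (real M + 1) * (\<Sum>j\<le>M. (real j + 1) * \<bar>S j\<bar>)
      \<le> 1 / 6 * (real M + 2) * (real M + 3)"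
    by (simp add: field_simps)
  from mult_right_mono[OF this e] first show ?thesis
    unfolding sum by (simp add: N)
qed

end
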